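(* The sum $L$ of a modular connected system has finite covers, i.e., every element of $L$ has finitely many upper covers and finitely many lower covers.
   Context: A lattice is l.f.f.c. if every closed interval is finite and every element has finitely many upper covers and finitely many lower covers. $x\lessdot y$ means $y$ covers $x$. A tolerance on a lattice $S$ is a reflexive, symmetric relation $\gamma$ with $a\,\gamma\,b$, $c\,\gamma\,d$ implying $(a\vee c)\,\gamma\,(b\vee d)$ and $(a\wedge c)\,\gamma\,(b\wedge d)$; $x\le_\gamma y$ means $x\le y$ and $x\,\gamma\,y$. A modular connected system $(S,\gamma,(L_x)_{x\in S},(\varphi_x^y)_{x\le_\gamma y})$ is a lattice $S$, a tolerance $\gamma$ on $S$, lattices $L_x$ and maps $\varphi_x^y$ satisfying: (MC1) $S$ is l.f.f.c.; (MC2) each $L_x$ is finite, modular, complemented; (MC3) each $\varphi_x^y$ is a lattice isomorphism from a nonempty lattice filter $F_x^y$ of $L_x$ onto a lattice ideal $I_x^y$ of $L_y$; (MC4) $F_x^x=I_x^x=L_x$, $\varphi_x^x=\mathrm{id}$; (MC5) if $x\le_\gamma y\le_\gamma z$ and $I_x^y\cap F_y^z\neq\emptyset$ then $x\,\gamma\,z$; (MC6) for $x\le z\le y$ with $x\,\gamma\,y$: $F_x^y=(\varphi_x^z)^{-1}(I_x^z\cap F_z^y)$, $I_x^y=\varphi_z^y(I_x^z\cap F_z^y)$, $\varphi_x^y=\varphi_z^y\circ\varphi_x^z|_{F_x^y}$; (MC7) if $x\,\gamma\,y$ then $I_x^{x\vee y}\cap I_y^{x\vee y}\subseteq I_{x\wedge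 y}^{x\vee y}$ and $F_{x\wedge y}^x\cap F_{x\wedge y}^y\subseteq F_{x\wedge y}^{x\vee y}$; (MC8.1) $x\lessdot y$ implies $x\,\gamma\,y$; (MC8.2) $x\lessdot y$ implies $F_x^y\neq L_x$ and $I_x^y\neq L_y$. Sum: $M=\{(x,a):x\in S,a\in L_x\}$, $(x,a)\sim(y,b)$ iff $x\,\gamma\,y$, $a\in F_x^{x\vee y}$, $b\in F_y^{x\vee y}$, $\varphi_x^{x\vee y}(a)=\varphi_y^{x\vee y}(b)$ (an equivalence relation); $L=M/{\sim}$; $\pi_x(a)$ is the class of $(x,a)$, $\Lambda_x=\pi_x(L_x)$. For $v\in S$, $a\le_v b$ iff $a,b\in\Lambda_v$ and $\pi_v^{-1}a\le\pi_v^{-1}b$ in $L_v$. $L$ is partially ordered by $a\le b$ iff there exist $n\ge0$, $x_1\le\dots\le x_n$ in $S$ and $a=a_0\le_{x_1}a_1\le_{x_2}\cdots\le_{x_n}a_n=b$. *)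

theory Defs
  imports "HOL-Algebra.Lattice"
begin

section \<open>Covers and finiteness conditions\<close>

definition covers :: "('a, 'c) gorder_scheme \<Rightarrow> 'a \<Rightarrow> 'a \<Rightarrow> bool"
  where "covers P x y \<longleftrightarrow>
    x \<in> carrier P \<and> y \<in> carrier P \<and> x \<sqsubset>\<^bsub>P\<^esub> y \<and>
    \<not> (\<exists>z\<in>carrier P. x \<sqsubset>\<^bsub>P\<^esub> z \<and> z \<sqsubset>\<^bsub>P\<^esub> y)"
  \<comment> \<open>\<open>covers P x y\<close>: the second argument \<open>y\<close> is the upper one.\<close>

definition has_finite_covers :: "('a, 'c) gorder_scheme \<Rightarrow> bool"
  where "has_finite_covers P \<longleftrightarrow>
    (\<forall>x\<in>carrier P. finite {y. covers P x y} \<and> finite {y. covers P y x})"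

definition lffc :: "('a, 'c) gorder_scheme \<Rightarrow> bool"
  where "lffc P \<longleftrightarrow>
    (\<forall>x\<in>carrier P. \<forall>y\<in>carrier P. finite \<lbrace>x..y\<rbrace>\<^bsub>P\<^esub>) \<and> has_finite_covers P"


section \<open>Lattice-theoretic notions\<close>

locale modular_lattice = lattice +
  assumes modular:
    "\<lbrakk>x \<in> carrier L; y \<in> carrier L; z \<in> carrier L; x \<sqsubseteq> z\<rbrakk>
      \<Longrightarrow> x \<squnion> (y \<sqinter> z) = (x \<squnion> y) \<sqinter> z"

locale complemented_lattice = bounded_lattice +
  assumes complement_exists:
    "x \<in> carrier L \<Longrightarrow> \<exists>y\<in>carrier L. x \<squnion> y = \<top> \<and> x \<sqinter> y = \<bottom>"

definition lattice_filter :: "('a, 'c) gorder_scheme \<Rightarrow> 'a set \<Rightarrow> bool"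
  where "lattice_filter L F \<longleftrightarrow> F \<subseteq> carrier L \<and>
    (\<forall>a\<in>F. \<forall>b\<in>carrier L. a \<sqsubseteq>\<^bsub>L\<^esub> b \<longrightarrow> b \<in> F) \<and>
    (\<forall>a\<in>F. \<forall>b\<in>F. a \<sqinter>\<^bsub>L\<^esub> b \<in> F)"

definition lattice_ideal :: "('a, 'c) gorder_scheme \<Rightarrow> 'a set \<Rightarrow> bool"
  where "lattice_ideal L I \<longleftrightarrow> I \<subseteq> carrier L \<and>
    (\<forall>a\<in>I. \<forall>b\<in>carrier L. b \<sqsubseteq>\<^bsub>L\<^esub> a \<longrightarrow> b \<in> I) \<and>
    (\<forall>a\<in>I. \<forall>b\<in>I. a \<squnion>\<^bsub>L\<^esub> b \<in> I)"

text \<open>Isomorphism between a sublattice \<open>A\<close> of \<open>K\<close> and a sublattice \<open>B\<close> of \<open>L\<close>.\<close>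

definition sublattice_iso ::
  "('a, 'c) gorder_scheme \<Rightarrow> 'a set \<Rightarrow> ('b, 'd) gorder_scheme \<Rightarrow> 'b set \<Rightarrow> ('a \<Rightarrow> 'b) \<Rightarrow> bool"
  where "sublattice_iso K A L B f \<longleftrightarrow> bij_betw f A B \<and>
    (\<forall>a\<in>A. \<forall>b\<in>A. f (a \<squnion>\<^bsub>K\<^esub> b) = f a \<squnion>\<^bsub>L\<^esub> f b \<and> f (a \<sqinter>\<^bsub>K\<^esub> b) = f a \<sqinter>\<^bsub>L\<^esub> f b)"

locale tolerance = lattice S for S :: "'a gorder" (structure) +
  fixes \<gamma> :: "'a rel"
  assumes tol_subset: "\<gamma> \<subseteq> carrier S \<times> carrier S"
    and tol_refl: "refl_on (carrier S) \<gamma>"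
    and tol_sym: "sym \<gamma>"
    and tol_join: "\<lbrakk>(a, b) \<in> \<gamma>; (c, d) \<in> \<gamma>\<rbrakk> \<Longrightarrow> (a \<squnion> c, b \<squnion> d) \<in> \<gamma>"
    and tol_meet: "\<lbrakk>(a, b) \<in> \<gamma>; (c, d) \<in> \<gamma>\<rbrakk> \<Longrightarrow> (a \<sqinter> c, b \<sqinter> d) \<in> \<gamma>"

definition tol_le :: "'a gorder \<Rightarrow> 'a rel \<Rightarrow> 'a \<Rightarrow> 'a \<Rightarrow> bool"
  where "tol_le S \<gamma> x y \<longleftrightarrow> x \<sqsubseteq>\<^bsub>S\<^esub> y \<and> (x, y) \<in> \<gamma>"


section \<open>Modular connected systems\<close>

text \<open>
  The lattices \<open>L x\<close> live on subsets of one common type \<open>'b\<close>; this is no restriction, as any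
  family of lattices can be moved into the disjoint union of its members. The connecting map from
  \<open>L x\<close> to \<open>L y\<close> is \<open>\<phi> x y\<close>, with domain \<open>F x y\<close> and image \<open>I x y\<close>. The values of \<open>F\<close>, \<open>I\<close> and
  \<open>\<phi>\<close> at pairs not satisfying \<open>tol_le S \<gamma> x y\<close>, and of \<open>\<phi> x y\<close> outside \<open>F x y\<close>, are irrelevant.
\<close>

locale modular_connected_system = tolerance S \<gamma>
  for S :: "'a gorder" (structure) and \<gamma> :: "'a rel" +
  fixes L :: "'a \<Rightarrow> 'b gorder"
    and F :: "'a \<Rightarrow> 'a \<Rightarrow> 'b set"
    and I :: "'a \<Rightarrow> 'a \<Rightarrow> 'b set"
    and \<phi> :: "'a \<Rightarrow> 'a \<Rightarrow> 'b \<Rightarrow> 'b"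
  assumes MC1: "lffc S"
    and MC2: "x \<in> carrier S \<Longrightarrow>
      finite (carrier (L x)) \<and> modular_lattice (L x) \<and> complemented_lattice (L x)"
    and MC3: "tol_le S \<gamma> x y \<Longrightarrow>
      F x y \<noteq> {} \<and> lattice_filter (L x) (F x y) \<and> lattice_ideal (L y) (I x y) \<and>
      sublattice_iso (L x) (F x y) (L y) (I x y) (\<phi> x y)"
    and MC4: "x \<in> carrier S \<Longrightarrow>
      F x x = carrier (L x) \<and> I x x = carrier (L x) \<and> (\<forall>a\<in>carrier (L x). \<phi> x x a = a)"
    and MC5: "\<lbrakk>tol_le S \<gamma> x y; tol_le S \<gamma> y z; I x y \<inter> F y z \<noteq> {}\<rbrakk> \<Longrightarrow> (x, z) \<in> \<gamma>"
    and MC6: "\<lbrakk>z \<in> carrier S; x \<sqsubseteq> z; z \<sqsubseteq> y; (x, y) \<in> \<gamma>\<rbrakk> \<Longrightarrow>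
      F x y = {a \<in> F x z. \<phi> x z a \<in> I x z \<inter> F z y} \<and>
      I x y = \<phi> z y ` (I x z \<inter> F z y) \<and>
      (\<forall>a\<in>F x y. \<phi> x y a = \<phi> z y (\<phi> x z a))"
    and MC7: "(x, y) \<in> \<gamma> \<Longrightarrow>
      I x (x \<squnion> y) \<inter> I y (x \<squnion> y) \<subseteq> I (x \<sqinter> y) (x \<squnion> y) \<and>
      F (x \<sqinter> y) x \<inter> F (x \<sqinter> y) y \<subseteq> F (x \<sqinter> y) (x \<squnion> y)"
    and MC8_1: "covers S x y \<Longrightarrow> (x, y) \<in> \<gamma>"
    and MC8_2: "covers S x y \<Longrightarrow> F x y \<noteq> carrier (L x) \<and> I x y \<noteq> carrier (L y)"


section \<open>The sum of a modular connected system\<close>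

definition mcs_union :: "'a gorder \<Rightarrow> ('a \<Rightarrow> 'b gorder) \<Rightarrow> ('a \<times> 'b) set"
  where "mcs_union S L = (SIGMA x:carrier S. carrier (L x))"

definition mcs_rel :: "'a gorder \<Rightarrow> 'a rel \<Rightarrow> ('a \<Rightarrow> 'b gorder) \<Rightarrow> ('a \<Rightarrow> 'a \<Rightarrow> 'b set)
    \<Rightarrow> ('a \<Rightarrow> 'a \<Rightarrow> 'b \<Rightarrow> 'b) \<Rightarrow> ('a \<times> 'b) rel"
  where "mcs_rel S \<gamma> L F \<phi> =
    {((x, a), (y, b)) | x a y b.
      (x, a) \<in> mcs_union S L \<and> (y, b) \<in> mcs_union S L \<and> (x, y) \<in> \<gamma> \<and>
      a \<in> F x (x \<squnion>\<^bsub>S\<^esub> y) \<and> b \<in> F y (x \<squnion>\<^bsub>S\<^esub> y) \<and>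
      \<phi> x (x \<squnion>\<^bsub>S\<^esub> y) a = \<phi> y (x \<squnion>\<^bsub>S\<^esub> y) b}"

definition mcs_proj :: "'a gorder \<Rightarrow> 'a rel \<Rightarrow> ('a \<Rightarrow> 'b gorder) \<Rightarrow> ('a \<Rightarrow> 'a \<Rightarrow> 'b set)
    \<Rightarrow> ('a \<Rightarrow> 'a \<Rightarrow> 'b \<Rightarrow> 'b) \<Rightarrow> 'a \<Rightarrow> 'b \<Rightarrow> ('a \<times> 'b) set"
  where "mcs_proj S \<gamma> L F \<phi> x a = mcs_rel S \<gamma> L F \<phi> `` {(x, a)}"

definition mcs_block :: "'a gorder \<Rightarrow> 'a rel \<Rightarrow> ('a \<Rightarrow> 'b gorder) \<Rightarrow> ('a \<Rightarrow> 'a \<Rightarrow> 'b set)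
    \<Rightarrow> ('a \<Rightarrow> 'a \<Rightarrow> 'b \<Rightarrow> 'b) \<Rightarrow> 'a \<Rightarrow> ('a \<times> 'b) set set"
  where "mcs_block S \<gamma> L F \<phi> x = mcs_proj S \<gamma> L F \<phi> x ` carrier (L x)"

text \<open>The relation \<open>a \<le>\<^sub>v b\<close>; each \<open>mcs_proj \<dots> v\<close> is injective on \<open>carrier (L v)\<close> by (MC4).\<close>

definition mcs_local_le :: "'a gorder \<Rightarrow> 'a rel \<Rightarrow> ('a \<Rightarrow> 'b gorder) \<Rightarrow> ('a \<Rightarrow> 'a \<Rightarrow> 'b set)
    \<Rightarrow> ('a \<Rightarrow> 'a \<Rightarrow> 'b \<Rightarrow> 'b) \<Rightarrow> 'a \<Rightarrow> ('a \<times> 'b) set \<Rightarrow> ('a \<times> 'b) set \<Rightarrow> bool"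
  where "mcs_local_le S \<gamma> L F \<phi> v a b \<longleftrightarrow>
    a \<in> mcs_block S \<gamma> L F \<phi> v \<and> b \<in> mcs_block S \<gamma> L F \<phi> v \<and>
    inv_into (carrier (L v)) (mcs_proj S \<gamma> L F \<phi> v) a
      \<sqsubseteq>\<^bsub>L v\<^esub> inv_into (carrier (L v)) (mcs_proj S \<gamma> L F \<phi> v) b"

definition mcs_sum :: "'a gorder \<Rightarrow> 'a rel \<Rightarrow> ('a \<Rightarrow> 'b gorder) \<Rightarrow> ('a \<Rightarrow> 'a \<Rightarrow> 'b set)
    \<Rightarrow> ('a \<Rightarrow> 'a \<Rightarrow> 'b \<Rightarrow> 'b) \<Rightarrow> ('a \<times> 'b) set gorder"
  where "mcs_sum S \<gamma> L F \<phi> =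
    \<lparr>carrier = mcs_union S L // mcs_rel S \<gamma> L F \<phi>,
     eq = (=),
     le = (\<lambda>a b. \<exists>n x c. c 0 = a \<and> c n = b \<and>
       (\<forall>i\<in>{1..n}. x i \<in> carrier S \<and> mcs_local_le S \<gamma> L F \<phi> (x i) (c (i - 1)) (c i)) \<and>
       (\<forall>i\<in>{1..<n}. x i \<sqsubseteq>\<^bsub>S\<^esub> x (Suc i)))\<rparr>"

end

theory Submission
  imports Defs
begin

text \<open>
  A covering pair of the sum lies in a common block \<open>\<Lambda>\<^sub>v\<close>, and the blocks containing the class
  of \<open>(x, a)\<close> have indices \<open>v \<gamma> x\<close>. As blocks are finite, it suffices that every \<open>x\<close> has only
  finitely many \<open>\<gamma>\<close>-neighbours. Above \<open>x\<close>, (MC8.2) makes the filters \<open>F x z\<close> of the finite lattice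
  \<open>L x\<close> shrink strictly along covers, so all neighbours are reached within boundedly many covering
  steps; dually, the ideals \<open>I z x\<close> shrink below \<open>x\<close>. A general neighbour \<open>v\<close> lies below the
  neighbour \<open>x \<squnion> v\<close> of \<open>x\<close>.
\<close>

section \<open>Existence of covers inside finite intervals\<close>

text \<open>A minimal element \<open>z\<close> of \<open>?A\<close> works: \<open>?A\<close> is
  finite and contains \<open>y\<close>, and anything strictly between \<open>x\<close> and
  \<open>z\<close> would again lie in \<open>?A\<close>, against minimality.\<close>

lemma (in partial_order) ex_upper_cover_below:
  assumes "x \<in> carrier L" "y \<in> carrier L" "x \<sqsubset> y" "finite \<lbrace>x..y\<rbrace>"
  shows "\<exists>z. covers L x z \<and> z \<sqsubseteq> y"
proof -
  let ?A = "{z \<in> carrier L. x \<sqsubset> z \<and> z \<sqsubseteq> y}"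
  have "finite ?A"
    using assms(4) by (rule finite_subset[rotated]) (auto simp: at_least_at_most_def lless_eq)
  moreover have "asymp_on ?A (\<sqsubset>)"
    by (rule asymp_onI) (use assms in \<open>auto dest: lless_antisym\<close>)
  moreover have "transp_on ?A (\<sqsubset>)"
    by (rule transp_onI) (use assms in \<open>auto intro: lless_trans\<close>)
  moreover have "?A \<noteq> {}"
    using assms by (auto simp: lless_eq)
  ultimately obtain z where z: "z \<in> ?A" "\<forall>u\<in>?A. u \<noteq> z \<longrightarrow> \<not> u \<sqsubset> z"
    by (metis (no_types, lifting) Finite_Set.bex_min_element)
  have "\<not> (x \<sqsubset> u \<and> u \<sqsubset> z)" if "u \<in> carrier L" for u
  proof
    assume u: "x \<sqsubset> u \<and> u \<sqsubset> z"
    then have "u \<sqsubseteq> y"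
      using z(1) that assms(2) le_trans[of u z y] by (simp add: lless_eq)
    then have "u \<in> ?A"
      using u that by auto
    then show False
      using u z(2) by (auto simp: lless_eq)
  qed
  then show ?thesis
    using z(1) assms(1) by (auto simp: covers_def)
qed

text \<open>Dual argument: a maximal element of \<open>?A\<close>, which contains
  \<open>x\<close>.\<close>

lemma (in partial_order) ex_lower_cover_above:
  assumes "x \<in> carrier L" "y \<in> carrier L" "x \<sqsubset> y" "finite \<lbrace>x..y\<rbrace>"
  shows "\<exists>z. covers L z y \<and> x \<sqsubseteq> z"
proof -
  let ?A = "{z \<in> carrier L. x \<sqsubseteq> z \<and> z \<sqsubset> y}"
  have "finite ?A"
    using assms(4) by (rule finite_subset[rotated]) (auto simp: at_least_at_most_def lless_eq)
  moreover have "asymp_on ?A (\<sqsubset>)"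
    by (rule asymp_onI) (use assms in \<open>auto dest: lless_antisym\<close>)
  moreover have "transp_on ?A (\<sqsubset>)"
    by (rule transp_onI) (use assms in \<open>auto intro: lless_trans\<close>)
  moreover have "?A \<noteq> {}"
    using assms by (auto simp: lless_eq)
  ultimately obtain z where z: "z \<in> ?A" "\<forall>u\<in>?A. u \<noteq> z \<longrightarrow> \<not> z \<sqsubset> u"
    by (metis (no_types, lifting) Finite_Set.bex_max_element)
  have "\<not> (z \<sqsubset> u \<and> u \<sqsubset> y)" if "u \<in> carrier L" for u
  proof
    assume u: "z \<sqsubset> u \<and> u \<sqsubset> y"
    then have "x \<sqsubseteq> u"
      using z(1) that assms(1) le_trans[of x z u] by (simp add: lless_eq)
    then have "u \<in> ?A"
      using u that by auto
    then show False
      using u z(2) by (auto simp: lless_eq)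
  qed
  then show ?thesis
    using z(1) assms(2) by (auto simp: covers_def)
qed

section \<open>Bounds in filters and ideals; convexity of tolerances\<close>

lemma (in complemented_lattice) bottom_in_lattice_ideal:
  assumes "lattice_ideal L J" "J \<noteq> {}"
  shows "\<bottom> \<in> J"
  using assms bottom_closed bottom_lower unfolding lattice_ideal_def by blast

lemma (in complemented_lattice) top_in_lattice_filter:
  assumes "lattice_filter L G" "G \<noteq> {}"
  shows "\<top> \<in> G"
  using assms top_closed top_higher unfolding lattice_filter_def by blast

lemma (in complemented_lattice) lattice_filter_eq_carrier:
  assumes "lattice_filter L G" "\<bottom> \<in> G"
  shows "G = carrier L"
  using assms bottom_lower unfolding lattice_filter_def by blast

lemma (in complemented_lattice) lattice_ideal_eq_carrier:
  assumes "lattice_ideal L J" "\<top> \<in> J"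
  shows "J = carrier L"
  using assms top_higher unfolding lattice_ideal_def by blast

lemma (in tolerance) tol_closed: "(x, y) \<in> \<gamma> \<Longrightarrow> x \<in> carrier S \<and> y \<in> carrier S"
  using tol_subset by auto

text \<open>Joining the pair \<open>(x, y)\<close> with \<open>(z, z)\<close> and then meeting with
  \<open>(w, w)\<close> sends \<open>x\<close> to \<open>z\<close> and \<open>y\<close> to
  \<open>w\<close>.\<close>

lemma (in tolerance) tol_convex:
  assumes "(x, y) \<in> \<gamma>" "z \<in> carrier S" "w \<in> carrier S" "x \<sqsubseteq> z" "z \<sqsubseteq> w" "w \<sqsubseteq> y"
  shows "(z, w) \<in> \<gamma>"
proof -
  have xy: "x \<in> carrier S" "y \<in> carrier S"
    using assms(1) tol_closed by auto
  have "(z, z) \<in> \<gamma>" "(w, w) \<in> \<gamma>"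
    using assms(2,3) tol_refl by (auto simp: refl_on_def)
  then have "((x \<squnion> z) \<sqinter> w, (y \<squnion> z) \<sqinter> w) \<in> \<gamma>"
    using assms(1) tol_join tol_meet by blast
  moreover have "x \<squnion> z = z"
    using assms xy by (simp add: le_iff_meet)
  moreover have "z \<sqinter> w = z"
    using assms by (metis le_iff_join)
  moreover have "y \<squnion> z = y"
    using assms xy by (metis join_comm le_iff_meet le_trans)
  moreover have "y \<sqinter> w = w"
    using assms xy by (metis meet_comm le_iff_join)
  ultimately show ?thesis
    by simp
qed

section \<open>Finiteness of the set of tolerance neighbours\<close>

context modular_connected_system
begin

lemma finite_interval: "\<lbrakk>x \<in> carrier S; y \<in> carrier S\<rbrakk> \<Longrightarrow> finite \<lbrace>x..y\<rbrace>"
  using MC1 by (simp add: lffc_def)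

lemma finite_covers:
  "x \<in> carrier S \<Longrightarrow> finite {y. covers S x y}"
  "x \<in> carrier S \<Longrightarrow> finite {y. covers S y x}"
  using MC1 by (auto simp: lffc_def has_finite_covers_def)

lemma finite_F: "tol_le S \<gamma> x y \<Longrightarrow> finite (F x y)"
  using MC3[of x y] MC2[of x] tol_closed[of x y]
  by (auto simp: lattice_filter_def tol_le_def intro: finite_subset)

lemma finite_I: "tol_le S \<gamma> x y \<Longrightarrow> finite (I x y)"
  using MC3[of x y] MC2[of y] tol_closed[of x y]
  by (auto simp: lattice_ideal_def tol_le_def intro: finite_subset)

lemma image_F: "tol_le S \<gamma> x y \<Longrightarrow> \<phi> x y ` F x y = I x y"
  using MC3[of x y] by (auto simp: sublattice_iso_def bij_betw_def)

lemma inj_on_F: "tol_le S \<gamma> x y \<Longrightarrow> inj_on (\<phi> x y) (F x y)"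
  using MC3[of x y] by (auto simp: sublattice_iso_def bij_betw_def)

text \<open>By (MC6), equality would put the whole ideal \<open>I x z\<close> into the filter
  \<open>F z w\<close>. The ideal contains the bottom of \<open>L z\<close>, so \<open>F z w\<close>
  would be all of \<open>L z\<close>, contradicting (MC8.2).\<close>

lemma F_psubset:
  assumes "covers S z w" "x \<sqsubseteq> z" "(x, w) \<in> \<gamma>"
  shows "F x w \<subset> F x z"
proof -
  have S: "x \<in> carrier S" "z \<in> carrier S" "w \<in> carrier S" "z \<sqsubseteq> w"
    using assms tol_closed by (auto simp: covers_def lless_def)
  have xz: "tol_le S \<gamma> x z" and zw: "tol_le S \<gamma> z w"
    using assms S tol_convex[of x w x z] MC8_1 by (auto simp: tol_le_def)
  have F: "F x w = {a \<in> F x z. \<phi> x z a \<in> I x z \<inter> F z w}"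
    using MC6[of z x w] S assms by blast
  have "F x w \<noteq> F x z"
  proof
    assume "F x w = F x z"
    then have *: "I x z \<subseteq> F z w"
      using F unfolding image_F[OF xz, symmetric] by blast
    interpret Lz: complemented_lattice "L z"
      using MC2 S by blast
    have "I x z \<noteq> {}"
      using image_F[OF xz] MC3[OF xz] by auto
    then have "bottom (L z) \<in> F z w"
      using * MC3[OF xz] Lz.bottom_in_lattice_ideal by blast
    then have "F z w = carrier (L z)"
      using MC3[OF zw] Lz.lattice_filter_eq_carrier by blast
    then show False
      using MC8_2 assms(1) by blast
  qed
  then show ?thesis
    using F by auto
qed

text \<open>Dually, equality would put the filter \<open>F z x\<close>, and with it the top of
  \<open>L z\<close>, into the ideal \<open>I w z\<close>.\<close>

lemma I_psubset:
  assumes "covers S w z" "z \<sqsubseteq> x" "(w, x) \<in> \<gamma>"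
  shows "I w x \<subset> I z x"
proof -
  have S: "x \<in> carrier S" "z \<in> carrier S" "w \<in> carrier S" "w \<sqsubseteq> z"
    using assms tol_closed by (auto simp: covers_def lless_def)
  have zx: "tol_le S \<gamma> z x" and wz: "tol_le S \<gamma> w z"
    using assms S tol_convex[of w x z x] MC8_1 by (auto simp: tol_le_def)
  have I: "I w x = \<phi> z x ` (I w z \<inter> F z x)"
    using MC6[of z w x] S assms by blast
  have "I w x \<noteq> I z x"
  proof
    assume "I w x = I z x"
    \<comment> \<open>The two ideals are compared as images under the same map; its injectivity on
      \<open>F z x\<close> reduces this to a comparison of subsets of \<open>L z\<close>.\<close>
    then have "\<phi> z x ` (I w z \<inter> F z x) = \<phi> z x ` F z x"
      using I image_F[OF zx] by simp
    then have *: "F z x \<subseteq> I w z"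
      using inj_on_image_eq_iff[OF inj_on_F[OF zx]] by blast
    interpret Lz: complemented_lattice "L z"
      using MC2 S by blast
    have "top (L z) \<in> I w z"
      using * MC3[OF zx] Lz.top_in_lattice_filter by blast
    then have "I w z = carrier (L z)"
      using MC3[OF wz] Lz.lattice_ideal_eq_carrier by blast
    then show False
      using MC8_2 assms(1) by blast
  qed
  then show ?thesis
    using I image_F[OF zx] by auto
qed

text \<open>Every neighbour \<open>v\<close> of \<open>x\<close> strictly above \<open>z\<close>
  lies above some upper cover \<open>w\<close> of \<open>z\<close>, and convexity makes
  \<open>w\<close> a neighbour of \<open>x\<close> too. There are finitely many such
  \<open>w\<close>, and each has a smaller filter \<open>F x w\<close>, so induction on the size of
  the filter applies.\<close>

lemma finite_tol_above_aux:
  "tol_le S \<gamma> x z \<Longrightarrow> finite {v. (x, v) \<in> \<gamma> \<and> z \<sqsubseteq> v}"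
proof (induction "card (F x z)" arbitrary: z rule: less_induct)
  case less
  have S: "x \<in> carrier S" "z \<in> carrier S" "x \<sqsubseteq> z"
    using less.prems tol_closed by (auto simp: tol_le_def)
  let ?C = "{w. covers S z w \<and> (x, w) \<in> \<gamma>}"
  have "{v. (x, v) \<in> \<gamma> \<and> z \<sqsubseteq> v} \<subseteq> {z} \<union> (\<Union>w\<in>?C. {v. (x, v) \<in> \<gamma> \<and> w \<sqsubseteq> v})"
  proof
    fix v assume "v \<in> {v. (x, v) \<in> \<gamma> \<and> z \<sqsubseteq> v}"
    then have v: "(x, v) \<in> \<gamma>" "z \<sqsubseteq> v" "v \<in> carrier S"
      using tol_closed by auto
    show "v \<in> {z} \<union> (\<Union>w\<in>?C. {v. (x, v) \<in> \<gamma> \<and> w \<sqsubseteq> v})"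
    proof (cases "v = z")
      case False
      then have "z \<sqsubset> v"
        using v by (simp add: lless_eq)
      then obtain w where w: "covers S z w" "w \<sqsubseteq> v"
        using ex_upper_cover_below finite_interval S v by blast
      then have wS: "w \<in> carrier S" "z \<sqsubseteq> w"
        by (auto simp: covers_def lless_def)
      then have "x \<sqsubseteq> w"
        using S le_trans by blast
      then have "(x, w) \<in> \<gamma>"
        using tol_convex[of x v x w] v w S wS by simp
      then show ?thesis
        using v w by blast
    qed simp
  qed
  moreover have "finite {v. (x, v) \<in> \<gamma> \<and> w \<sqsubseteq> v}" if w: "w \<in> ?C" for w
  proof (rule less.hyps)
    have "F x w \<subset> F x z"
      using w S by (intro F_psubset) auto
    then show "card (F x w) < card (F x z)"
      by (rule psubset_card_mono[OF finite_F[OF less.prems]])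
    have "w \<in> carrier S" "z \<sqsubseteq> w"
      using w by (auto simp: covers_def lless_def)
    then show "tol_le S \<gamma> x w"
      using w S le_trans[of x z w] by (simp add: tol_le_def)
  qed
  moreover have "finite ?C"
    using finite_covers(1)[OF S(2)] by (rule finite_subset[rotated]) auto
  ultimately show ?case
    by (blast intro: finite_subset)
qed

text \<open>The same induction downwards, on the size of \<open>I z x\<close> and through lower
  covers of \<open>z\<close>.\<close>

lemma finite_tol_below_aux:
  "tol_le S \<gamma> z x \<Longrightarrow> finite {v. (v, x) \<in> \<gamma> \<and> v \<sqsubseteq> z}"
proof (induction "card (I z x)" arbitrary: z rule: less_induct)
  case less
  have S: "x \<in> carrier S" "z \<in> carrier S" "z \<sqsubseteq> x"
    using less.prems tol_closed by (auto simp: tol_le_def)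
  let ?C = "{w. covers S w z \<and> (w, x) \<in> \<gamma>}"
  have "{v. (v, x) \<in> \<gamma> \<and> v \<sqsubseteq> z} \<subseteq> {z} \<union> (\<Union>w\<in>?C. {v. (v, x) \<in> \<gamma> \<and> v \<sqsubseteq> w})"
  proof
    fix v assume "v \<in> {v. (v, x) \<in> \<gamma> \<and> v \<sqsubseteq> z}"
    then have v: "(v, x) \<in> \<gamma>" "v \<sqsubseteq> z" "v \<in> carrier S"
      using tol_closed by auto
    show "v \<in> {z} \<union> (\<Union>w\<in>?C. {v. (v, x) \<in> \<gamma> \<and> v \<sqsubseteq> w})"
    proof (cases "v = z")
      case False
      then have "v \<sqsubset> z"
        using v by (simp add: lless_eq)
      then obtain w where w: "covers S w z" "v \<sqsubseteq> w"
        using ex_lower_cover_above finite_interval S v by blast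
      then have wS: "w \<in> carrier S" "w \<sqsubseteq> z"
        by (auto simp: covers_def lless_def)
      then have "w \<sqsubseteq> x"
        using S le_trans by blast
      then have "(w, x) \<in> \<gamma>"
        using tol_convex[of v x w x] v w S wS by simp
      then show ?thesis
        using v w by blast
    qed simp
  qed
  moreover have "finite {v. (v, x) \<in> \<gamma> \<and> v \<sqsubseteq> w}" if w: "w \<in> ?C" for w
  proof (rule less.hyps)
    have "I w x \<subset> I z x"
      using w S by (intro I_psubset) auto
    then show "card (I w x) < card (I z x)"
      by (rule psubset_card_mono[OF finite_I[OF less.prems]])
    have "w \<in> carrier S" "w \<sqsubseteq> z"
      using w by (auto simp: covers_def lless_def)
    then show "tol_le S \<gamma> w x"
      using w S le_trans[of w z x] by (simp add: tol_le_def)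
  qed
  moreover have "finite ?C"
    using finite_covers(2)[OF S(2)] by (rule finite_subset[rotated]) auto
  ultimately show ?case
    by (blast intro: finite_subset)
qed

lemma finite_tol_neighbours:
  assumes "x \<in> carrier S"
  shows "finite {v. (x, v) \<in> \<gamma>}"
proof -
  have refl: "(y, y) \<in> \<gamma>" "tol_le S \<gamma> y y" if "y \<in> carrier S" for y
    using that tol_refl by (auto simp: tol_le_def refl_on_def)
  let ?U = "{u. (x, u) \<in> \<gamma> \<and> x \<sqsubseteq> u}"
  have "{v. (x, v) \<in> \<gamma>} \<subseteq> (\<Union>u\<in>?U. {v. (v, u) \<in> \<gamma> \<and> v \<sqsubseteq> u})"
  proof
    fix v assume "v \<in> {v. (x, v) \<in> \<gamma>}"
    then have v: "(x, v) \<in> \<gamma>" "v \<in> carrier S"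
      using tol_closed by auto
    \<comment> \<open>Joining \<open>(x, v)\<close> with \<open>(x, x)\<close> and with
      \<open>(v, v)\<close> relates \<open>x \<squnion> v\<close> to both \<open>x\<close> and
      \<open>v\<close>.\<close>
    have "(x \<squnion> x, x \<squnion> v) \<in> \<gamma>" "(x \<squnion> v, v \<squnion> v) \<in> \<gamma>"
      using tol_join v refl assms by blast+
    \<comment> \<open>Read backwards, \<open>le_iff_meet\<close> turns these equations into
      reflexivity of the order.\<close>
    moreover have "x \<squnion> x = x" "v \<squnion> v = v"
      using assms v by (simp_all flip: le_iff_meet)
    ultimately have "(x, x \<squnion> v) \<in> \<gamma>" "(v, x \<squnion> v) \<in> \<gamma>"
      using tol_sym by (auto dest: symD)
    then show "v \<in> (\<Union>u\<in>?U. {v. (v, u) \<in> \<gamma> \<and> v \<sqsubseteq> u})"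
      using join_left[OF assms v(2)] join_right[OF assms v(2)] by blast
  qed
  moreover have "finite ?U"
    using finite_tol_above_aux[OF refl(2)[OF assms]] .
  moreover have "finite {v. (v, u) \<in> \<gamma> \<and> v \<sqsubseteq> u}" if "u \<in> ?U" for u
    using finite_tol_below_aux[OF refl(2)] tol_closed[of x u] that by simp
  ultimately show ?thesis
    by (blast intro: finite_subset)
qed

section \<open>Blocks of the sum\<close>

text \<open>Reflexivity of \<open>mcs_rel\<close>: since \<open>F x x\<close> is all of
  \<open>L x\<close> by (MC4), the pair \<open>(x, a)\<close> meets both filter conditions.\<close>

lemma mcs_proj_self:
  assumes "x \<in> carrier S" "a \<in> carrier (L x)"
  shows "(x, a) \<in> mcs_proj S \<gamma> L F \<phi> x a"
proof -
  have "x \<squnion> x = x"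
    using assms by (simp flip: le_iff_meet)
  moreover have "(x, x) \<in> \<gamma>"
    using assms tol_refl by (auto simp: refl_on_def)
  ultimately show ?thesis
    using assms MC4[of x] by (auto simp: mcs_proj_def mcs_rel_def mcs_union_def)
qed

text \<open>If the class of \<open>(x, a)\<close> is also the class of \<open>(v, b)\<close>, then
  it contains \<open>(v, b)\<close>, so \<open>x\<close> and \<open>v\<close> are related by
  \<open>\<gamma>\<close>. Hence the indices in question are among the finitely many neighbours of
  \<open>x\<close>.\<close>

lemma finite_blocks_of:
  assumes "p \<in> carrier (mcs_sum S \<gamma> L F \<phi>)"
  shows "finite {v \<in> carrier S. p \<in> mcs_block S \<gamma> L F \<phi> v}"
proof -
  obtain x a where x: "x \<in> carrier S" and p: "p = mcs_proj S \<gamma> L F \<phi> x a"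
    using assms by (auto simp: mcs_sum_def mcs_union_def mcs_proj_def elim!: quotientE)
  have "(x, v) \<in> \<gamma>" if v: "v \<in> carrier S" "p \<in> mcs_block S \<gamma> L F \<phi> v" for v
  proof -
    obtain b where b: "b \<in> carrier (L v)" "p = mcs_proj S \<gamma> L F \<phi> v b"
      using v by (auto simp: mcs_block_def)
    then have "(v, b) \<in> mcs_proj S \<gamma> L F \<phi> x a"
      using mcs_proj_self v p by auto
    then show ?thesis
      by (auto simp: mcs_proj_def mcs_rel_def)
  qed
  then show ?thesis
    using finite_tol_neighbours[OF x] by (auto intro: finite_subset[rotated])
qed

lemma finite_mcs_block: "v \<in> carrier S \<Longrightarrow> finite (mcs_block S \<gamma> L F \<phi> v)"
  unfolding mcs_block_def using MC2[of v] by (intro finite_imageI) simp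

lemma mcs_block_closed:
  "\<lbrakk>v \<in> carrier S; p \<in> mcs_block S \<gamma> L F \<phi> v\<rbrakk> \<Longrightarrow> p \<in> carrier (mcs_sum S \<gamma> L F \<phi>)"
  unfolding mcs_block_def mcs_proj_def mcs_sum_def mcs_union_def gorder.simps partial_object.simps
  by (blast intro: quotientI)

section \<open>Order and covers in the sum\<close>

lemma mcs_sum_le_iff:
  "p \<sqsubseteq>\<^bsub>mcs_sum S \<gamma> L F \<phi>\<^esub> q \<longleftrightarrow> (\<exists>n x c. c 0 = p \<and> c n = q \<and>
    (\<forall>i\<in>{1..n}. x i \<in> carrier S \<and> mcs_local_le S \<gamma> L F \<phi> (x i) (c (i - 1)) (c i)) \<and>
    (\<forall>i\<in>{1..<n}. x i \<sqsubseteq> x (Suc i)))"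
  by (simp only: mcs_sum_def gorder.simps)

lemma mcs_local_le_imp_le:
  assumes "v \<in> carrier S" "mcs_local_le S \<gamma> L F \<phi> v p q"
  shows "p \<sqsubseteq>\<^bsub>mcs_sum S \<gamma> L F \<phi>\<^esub> q"
proof -
  let ?c = "\<lambda>i :: nat. if i = 0 then p else q"
  have "?c 0 = p \<and> ?c 1 = q \<and>
    (\<forall>i\<in>{1..1}. v \<in> carrier S \<and> mcs_local_le S \<gamma> L F \<phi> v (?c (i - 1)) (?c i)) \<and>
    (\<forall>i\<in>{1..<1::nat}. v \<sqsubseteq> v)"
    using assms by simp
  then show ?thesis
    unfolding mcs_sum_le_iff by (intro exI)
qed

text \<open>In a chain of local steps from \<open>p\<close> to \<open>q\<close>, the first element
  different from \<open>p\<close> is reached from \<open>p\<close> within one block. It lies below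
  \<open>q\<close> by the rest of the chain, so the covering relation forces it to be
  \<open>q\<close>.\<close>

lemma covers_common_block:
  assumes "covers (mcs_sum S \<gamma> L F \<phi>) p q"
  shows "\<exists>v\<in>carrier S. p \<in> mcs_block S \<gamma> L F \<phi> v \<and> q \<in> mcs_block S \<gamma> L F \<phi> v"
proof -
  let ?M = "mcs_sum S \<gamma> L F \<phi>"
  have eq: "(p .=\<^bsub>?M\<^esub> q) = (p = q)" for p q
    by (simp only: mcs_sum_def eq_object.simps)
  have "p \<sqsubseteq>\<^bsub>?M\<^esub> q" "p \<noteq> q"
    using assms eq by (auto simp: covers_def lless_def)
  then obtain n x c where c: "c 0 = p" "c n = q"
    and step: "\<And>i. i \<in> {1..n} \<Longrightarrow>
      x i \<in> carrier S \<and> mcs_local_le S \<gamma> L F \<phi> (x i) (c (i - 1)) (c i)"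
    and mono: "\<And>i. i \<in> {1..<n} \<Longrightarrow> x i \<sqsubseteq> x (Suc i)"
    unfolding mcs_sum_le_iff by metis
  define i where "i = (LEAST i. c i \<noteq> p)"
  have i: "c i \<noteq> p" "i \<le> n"
    using \<open>p \<noteq> q\<close> c unfolding i_def by (metis (mono_tags) LeastI, metis (mono_tags) Least_le)
  \<comment> \<open>The chain starts at \<open>p\<close>, so \<open>i - 1\<close> is a genuine
    predecessor of \<open>i\<close>, and minimality of \<open>i\<close> gives
    \<open>c (i - 1) = p\<close>.\<close>
  then have "i \<noteq> 0"
    using c by metis
  then have "c (i - 1) = p"
    using not_less_Least[of "i - 1" "\<lambda>i. c i \<noteq> p"] by (auto simp: i_def)
  then have v: "x i \<in> carrier S" "mcs_local_le S \<gamma> L F \<phi> (x i) p (c i)"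
    using step[of i] i(2) \<open>i \<noteq> 0\<close> by auto
  then have blk: "p \<in> mcs_block S \<gamma> L F \<phi> (x i)" "c i \<in> mcs_block S \<gamma> L F \<phi> (x i)"
    by (auto simp: mcs_local_le_def)
  have "c i \<sqsubseteq>\<^bsub>?M\<^esub> q"
    unfolding mcs_sum_le_iff
  proof (intro exI conjI ballI)
    \<comment> \<open>The unsimplified sums fix the witnesses: length \<open>n - i\<close>, with the
      elements and the indices of the old chain shifted by \<open>i\<close>.\<close>
    show "c (i + 0) = c i" "c (i + (n - i)) = q"
      using c i by auto
  next
    fix j assume "j \<in> {1..n - i}"
    then show "x (i + j) \<in> carrier S"
      "mcs_local_le S \<gamma> L F \<phi> (x (i + j)) (c (i + (j - 1))) (c (i + j))"
      using step[of "i + j"] by auto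
  next
    fix j assume "j \<in> {1..<n - i}"
    then show "x (i + j) \<sqsubseteq> x (i + Suc j)"
      using mono[of "i + j"] by auto
  qed
  moreover have "p \<sqsubseteq>\<^bsub>?M\<^esub> c i"
    using mcs_local_le_imp_le v by blast
  moreover have "c i \<in> carrier ?M"
    using mcs_block_closed v blk by blast
  \<comment> \<open>Otherwise \<open>c i\<close> would lie strictly between \<open>p\<close> and
    \<open>q\<close>.\<close>
  ultimately have "c i = q"
    using assms i(1) eq by (auto simp: covers_def lless_def)
  then show ?thesis
    using v(1) blk by auto
qed

lemma has_finite_covers_mcs_sum: "has_finite_covers (mcs_sum S \<gamma> L F \<phi>)"
  unfolding has_finite_covers_def
proof (intro ballI)
  fix p assume p: "p \<in> carrier (mcs_sum S \<gamma> L F \<phi>)"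
  \<comment> \<open>A finite union of finite blocks that contains all upper and lower covers of
    \<open>p\<close>.\<close>
  let ?B = "\<Union>v\<in>{v \<in> carrier S. p \<in> mcs_block S \<gamma> L F \<phi> v}. mcs_block S \<gamma> L F \<phi> v"
  have "finite ?B"
    using finite_blocks_of[OF p] finite_mcs_block by blast
  moreover have "{q. covers (mcs_sum S \<gamma> L F \<phi>) p q} \<subseteq> ?B"
    "{q. covers (mcs_sum S \<gamma> L F \<phi>) q p} \<subseteq> ?B"
    using covers_common_block by blast+
  ultimately show "finite {q. covers (mcs_sum S \<gamma> L F \<phi>) p q} \<and>
      finite {q. covers (mcs_sum S \<gamma> L F \<phi>) q p}"
    by (blast intro: finite_subset)
qed

end

theorem theorem4p49:
  fixes S :: "'a gorder" and \<gamma> :: "'a rel" and L :: "'a \<Rightarrow> 'b gorder"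
    and F I :: "'a \<Rightarrow> 'a \<Rightarrow> 'b set" and \<phi> :: "'a \<Rightarrow> 'a \<Rightarrow> 'b \<Rightarrow> 'b"
  assumes "modular_connected_system S \<gamma> L F I \<phi>"
  shows "has_finite_covers (mcs_sum S \<gamma> L F \<phi>)"
  using assms by (rule modular_connected_system.has_finite_covers_mcs_sum)

end
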